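(* Let $n\ge1$, $\gamma\in\mathbb{R}$ and $n<p<+\infty$. There exists a constant $C>0$ such that, whenever $\omega\in C(\mathbb{R}^n_+\times\mathbb{R}^n_+,[0,+\infty))$ is such that every $u\in\dot W^{1,p}_\gamma(\mathbb{R}^n_+)$ satisfies, for almost every $x,y\in\mathbb{R}^n_+$, \[ |u(x)-u(y)|\le\omega(x,y)\Big(\int_{\mathbb{R}^n_+}|Du(z)|^pz_n^\gamma\,dz\Big)^{1/p}, \] then for all $x,y\in\mathbb{R}^n_+$, $\omega(x,y)\ge C\,\Theta_{1-\frac1p,\,1-\frac np,\,1-\frac{n+\gamma}{p}}(x,y)$.
   Context: $\mathbb{R}^n_+=\mathbb{R}^{n-1}\times(0,+\infty)$, points written $x=(x',x_n)$. $\dot W^{1,p}_\gamma(\mathbb{R}^n_+)=\{u\in W^{1,1}_{\mathrm{loc}}(\mathbb{R}^n_+): \int_{\mathbb{R}^n_+}|Du(z)|^p z_n^\gamma\,dz<+\infty\}$. For $\alpha>0$, $\beta,\kappa\in\mathbb{R}$: $\Theta_{\alpha,\beta,\kappa}(x,y)=\frac{|x-y|^\beta}{\min(x_n,y_n)^{-\kappa}\max(x_n,y_n,|x-y|)^\beta}$ if $\kappa<0$; $=\big(\ln(1+(|x-y|/\min(x_n,y_n))^{\beta/\alpha})\big)^\alpha$ if $\kappa=0$; $=\frac{|x-y|^\beta}{\max(x_n,y_n,|x-y|)^{\beta-\kappa}}$ if $0<\kappa<1+\beta-\alpha$; $=\frac{\max(x_n,y_n)^\kappa|x-y|^\beta}{\max(x_n,y_n,|x-y|)^\beta}$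 if $\kappa\ge 1+\beta-\alpha$. *)

theory Defs
  imports "HOL-Analysis.Analysis"
begin

text \<open>Upper half-space: the coordinate k plays the role of the last coordinate x_n.\<close>
definition halfspace :: "'n::finite \<Rightarrow> (real^'n) set" where
  "halfspace k = {x. x $ k > 0}"

definition partial :: "'n::finite \<Rightarrow> (real^'n \<Rightarrow> real) \<Rightarrow> real^'n \<Rightarrow> real" where
  "partial i f = (\<lambda>x. frechet_derivative f (at x) (axis i 1))"

definition smooth_fun :: "(real^'n::finite \<Rightarrow> real) \<Rightarrow> bool" where
  "smooth_fun f \<longleftrightarrow> (\<forall>is. (foldr partial is f) differentiable_on UNIV)"

definition tsupport :: "(real^'n::finite \<Rightarrow> real) \<Rightarrow> (real^'n) set" where
  "tsupport f = closure {x. f x \<noteq> 0}"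

definition test_fun :: "(real^'n::finite) set \<Rightarrow> (real^'n \<Rightarrow> real) \<Rightarrow> bool" where
  "test_fun U \<phi> \<longleftrightarrow> smooth_fun \<phi> \<and> compact (tsupport \<phi>) \<and> tsupport \<phi> \<subseteq> U"

definition locally_integrable_on :: "(real^'n::finite \<Rightarrow> real) \<Rightarrow> (real^'n) set \<Rightarrow> bool" where
  "locally_integrable_on f U \<longleftrightarrow> (\<forall>K. compact K \<and> K \<subseteq> U \<longrightarrow> set_integrable lborel K f)"

definition weak_gradient :: "(real^'n::finite) set \<Rightarrow> (real^'n \<Rightarrow> real) \<Rightarrow> (real^'n \<Rightarrow> real^'n) \<Rightarrow> bool" where
  "weak_gradient U u G \<longleftrightarrow>
     locally_integrable_on u U \<and> (\<forall>i. locally_integrable_on (\<lambda>x. G x $ i) U) \<and>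
     (\<forall>\<phi> i. test_fun U \<phi> \<longrightarrow>
        (LINT x:U|lborel. u x * partial i \<phi> x) = - (LINT x:U|lborel. G x $ i * \<phi> x))"

definition wenergy :: "'n::finite \<Rightarrow> real \<Rightarrow> real \<Rightarrow> (real^'n \<Rightarrow> real^'n) \<Rightarrow> ennreal" where
  "wenergy k p \<gamma> G = (\<integral>\<^sup>+ z\<in>halfspace k. ennreal (norm (G z) powr p * (z $ k) powr \<gamma>) \<partial>lborel)"

definition Theta :: "'n::finite \<Rightarrow> real \<Rightarrow> real \<Rightarrow> real \<Rightarrow> real^'n \<Rightarrow> real^'n \<Rightarrow> real" where
  "Theta k \<alpha> \<beta> \<kappa> x y =
    (let d = dist x y; m = min (x$k) (y$k); M = max (x$k) (y$k); MM = max M d in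
     if \<kappa> < 0 then d powr \<beta> / (m powr (-\<kappa>) * MM powr \<beta>)
     else if \<kappa> = 0 then (ln (1 + (d / m) powr (\<beta> / \<alpha>))) powr \<alpha>
     else if \<kappa> < 1 + \<beta> - \<alpha> then d powr \<beta> / MM powr (\<beta> - \<kappa>)
     else M powr \<kappa> * d powr \<beta> / MM powr \<beta>)"

end

theory Submission
  imports Defs
begin

text \<open>
  A continuous modulus \<open>\<omega>\<close> dominates every admissible function of class $C^1$ at every pair of
  points, so it suffices to exhibit, for each pair, one function whose oscillation is large compared
  with its energy. Let \<open>m \<le> M\<close> be the heights of the two points and \<open>d\<close> their distance.
  A radial bump of radius \<open>r\<close>, centred at one of the points and vanishing at the other one, has energy
  of order \<open>r^(n-p) h^\<gamma>\<close> when its centre has height \<open>h \<ge> 2 r\<close>, and of order \<open>r^(n+\<gamma>-p)\<close> when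
  \<open>\<gamma> > -1\<close> and \<open>h \<le> r\<close>. If \<open>d < m\<close>, a bump at the lower point of radius \<open>d/2\<close> works. If \<open>d \<ge> m\<close>, take radius
  \<open>m/2\<close> at the lower point for \<open>\<kappa> < 0\<close>, radius \<open>d\<close> at the lower point for
  \<open>0 < \<kappa> < 1 + \<beta> - \<alpha>\<close>, and radius \<open>M/2\<close> at the higher point for \<open>\<kappa> \<ge> 1 + \<beta> - \<alpha>\<close>.
  For \<open>\<kappa> = 0\<close> the energy of a bump is independent of its radius, and the sum of the bumps of radii
  \<open>m 2^j \<le> d\<close>, whose gradients have disjoint supports, produces the logarithm.
\<close>

subsection \<open>Weak gradients of functions of class $C^1$\<close>

text \<open>Each difference quotient \<open>s n\<close> has integral 0 by translation invariance of
  Lebesgue measure, and dominated convergence carries this over to the derivative. The mean value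
  theorem supplies the dominating function.\<close>

lemma integral_directional_derivative_eq_0:
  fixes f :: "'a::euclidean_space \<Rightarrow> real" and e :: 'a
  assumes der: "\<And>x. (f has_derivative f' x) (at x)"
    and cont: "continuous_on UNIV (\<lambda>x. f' x e)"
    and supp: "\<And>x. norm x > R \<Longrightarrow> f x = 0"
  shows "(LINT x|lborel. f' x e) = 0"
proof -
  define h :: "nat \<Rightarrow> real" where "h n = inverse (real (Suc n))" for n
  have h: "0 < h n" "h n \<le> 1" for n
    by (auto simp: h_def field_simps)
  have h_lim: "h \<longlonglongrightarrow> 0"
    unfolding h_def by (rule LIMSEQ_inverse_real_of_nat)
  define s where "s n x = (f (x + h n *\<^sub>R e) - f x) / h n" for n x
  have contf: "continuous_on UNIV f"
    using der by (meson continuous_at_imp_continuous_on has_derivative_continuous)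
  have [measurable]: "f \<in> borel_measurable borel" "(\<lambda>x. f' x e) \<in> borel_measurable borel"
    using contf cont by (auto intro: borel_measurable_continuous_onI)
  have line: "((\<lambda>t. f (x + t *\<^sub>R e)) has_real_derivative f' (x + t *\<^sub>R e) e) (at t)" for x t
  proof -
    have "((\<lambda>t. f (x + t *\<^sub>R e)) has_derivative (\<lambda>d. f' (x + t *\<^sub>R e) (d *\<^sub>R e))) (at t)"
      by (rule has_derivative_compose[OF _ der, of "\<lambda>t. x + t *\<^sub>R e"])
        (auto intro!: derivative_eq_intros)
    moreover have "(\<lambda>d. f' (x + t *\<^sub>R e) (d *\<^sub>R e)) = (*) (f' (x + t *\<^sub>R e) e)"
      using linear_scale[OF has_derivative_linear[OF der]] by (auto simp: fun_eq_iff)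
    ultimately show ?thesis
      by (simp add: has_field_derivative_def)
  qed
  \<comment> \<open>As \<open>h n \<le> 1\<close>, a point of norm at most \<open>R + norm e\<close>
    stays in this larger ball on its way to \<open>x + h n *\<^sub>R e\<close>. Farther out both
    endpoints have norm above \<open>R\<close>, and the quotient vanishes.\<close>
  have "compact ((\<lambda>x. f' x e) ` cball 0 (R + 2 * norm e))"
    using cont by (intro compact_continuous_image) (auto intro: continuous_on_subset)
  then obtain B where B: "\<And>x. x \<in> cball 0 (R + 2 * norm e) \<Longrightarrow> \<bar>f' x e\<bar> \<le> B"
    using compact_imp_bounded[THEN bounded_iff[THEN iffD1]] by (metis imageI real_norm_def)
  have bound: "norm (s n x) \<le> \<bar>B\<bar> * indicator (cball 0 (R + norm e)) x" for n x
  proof (cases "norm x \<le> R + norm e")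
    case True
    have "\<exists>t::real. t > 0 \<and> t < h n \<and>
        f (x + h n *\<^sub>R e) - f (x + 0 *\<^sub>R e) = (h n - 0) * f' (x + t *\<^sub>R e) e"
      by (rule MVT2[OF h(1)]) (rule line)
    then obtain t where t: "0 < t" "t < h n" "s n x = f' (x + t *\<^sub>R e) e"
      using h(1)[of n] by (auto simp: s_def field_simps)
    have "t * norm e \<le> 1 * norm e"
      using t h[of n] by (intro mult_right_mono) auto
    moreover have "norm (x + t *\<^sub>R e) \<le> norm x + t * norm e"
      using norm_triangle_ineq[of x "t *\<^sub>R e"] t by simp
    ultimately have "norm (x + t *\<^sub>R e) \<le> R + 2 * norm e"
      using True by linarith
    then show ?thesis
      using True t(3) B[of "x + t *\<^sub>R e"] by auto
  next
    case False
    have "h n * norm e \<le> 1 * norm e"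
      using h[of n] by (intro mult_right_mono) auto
    moreover have "norm x \<le> norm (x + h n *\<^sub>R e) + h n * norm e"
      using norm_triangle_ineq4[of "x + h n *\<^sub>R e" "h n *\<^sub>R e"] h[of n] by simp
    ultimately have "norm (x + h n *\<^sub>R e) > R"
      using False by linarith
    moreover have "norm x > R"
      using False norm_ge_zero[of e] by linarith
    ultimately show ?thesis
      using False by (simp add: s_def supp)
  qed
  have int: "integrable lborel f"
  proof -
    have "integrable lborel (\<lambda>x. indicator (cball 0 R) x *\<^sub>R f x)"
      by (rule borel_integrable_compact) (auto intro: continuous_on_subset[OF contf])
    also have "(\<lambda>x. indicator (cball 0 R) x *\<^sub>R f x) = f"
      using supp by (force simp: fun_eq_iff indicator_def)
    finally show ?thesis .
  qed
  have trans: "integrable lborel (\<lambda>x. f (x + c))" "(LINT x|lborel. f (x + c)) = (LINT x|lborel. f x)" for c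
  proof -
    have eq: "distr lborel borel ((+) c) = lborel"
      by (rule lborel_distr_plus)
    show "integrable lborel (\<lambda>x. f (x + c))"
      using int integrable_distr[of "(+) c" lborel borel f] by (simp add: eq add.commute)
    show "(LINT x|lborel. f (x + c)) = (LINT x|lborel. f x)"
      using integral_distr[of "(+) c" lborel borel f] by (simp add: eq add.commute)
  qed
  have "(\<lambda>n. LINT x|lborel. s n x) \<longlonglongrightarrow> (LINT x|lborel. f' x e)"
  proof (rule integral_dominated_convergence[where w = "\<lambda>x. \<bar>B\<bar> * indicator (cball 0 (R + norm e)) x"])
    show "AE x in lborel. (\<lambda>n. s n x) \<longlonglongrightarrow> f' x e"
    proof (rule AE_I2)
      fix x
      have "((\<lambda>d. (f (x + d *\<^sub>R e) - f x) / d) \<longlongrightarrow> f' x e) (at 0)"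
        using line[of x 0] by (simp add: DERIV_def)
      moreover have "filterlim h (at 0) sequentially"
        unfolding filterlim_at using h_lim h(1) by (simp add: less_imp_neq[symmetric])
      ultimately show "(\<lambda>n. s n x) \<longlonglongrightarrow> f' x e"
        unfolding s_def by (rule filterlim_compose)
    qed
    show "AE x in lborel. norm (s n x) \<le> \<bar>B\<bar> * indicator (cball 0 (R + norm e)) x" for n
      using bound by blast
    show "s n \<in> borel_measurable lborel" for n
      unfolding s_def by measurable
    show "integrable lborel (\<lambda>x::'a. \<bar>B\<bar> * indicator (cball 0 (R + norm e)) x :: real)"
      using emeasure_lborel_cball_finite[of "0::'a" "R + norm e"]
      by (intro integrable_mult_right integrable_real_indicator) auto
  qed measurable
  moreover have "(LINT x|lborel. s n x) = 0" for n
    unfolding s_def using int trans by simp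
  ultimately show ?thesis
    by (simp add: LIMSEQ_const_iff)
qed

text \<open>Of smoothness only the lists \<open>[]\<close> and \<open>[i]\<close> enter:
  differentiability of \<phi> and of its first partials, which are therefore continuous.\<close>

lemma smooth_fun_continuous_partials:
  assumes "smooth_fun \<phi>"
  shows "(\<phi> has_derivative (\<lambda>h. \<Sum>i\<in>UNIV. h $ i * partial i \<phi> x)) (at x)"
    and "continuous_on UNIV (partial i \<phi>)"
proof -
  have "foldr partial [] \<phi> differentiable_on UNIV" "foldr partial [i] \<phi> differentiable_on UNIV"
    using assms unfolding smooth_fun_def by blast+
  then have *: "\<phi> differentiable (at x)" "partial i \<phi> differentiable_on UNIV"
    by (auto simp: differentiable_on_def)
  then show "continuous_on UNIV (partial i \<phi>)"
    by (intro differentiable_imp_continuous_on)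
  have d: "(\<phi> has_derivative frechet_derivative \<phi> (at x)) (at x)"
    using * frechet_derivative_works by blast
  have "frechet_derivative \<phi> (at x) h = (\<Sum>i\<in>UNIV. h $ i * partial i \<phi> x)" for h
  proof -
    have "frechet_derivative \<phi> (at x) (\<Sum>i\<in>UNIV. h $ i *s axis i 1)
        = (\<Sum>i\<in>UNIV. h $ i * frechet_derivative \<phi> (at x) (axis i 1))"
      using has_derivative_linear[OF d]
      by (simp add: linear_sum linear_scale scalar_mult_eq_scaleR)
    then show ?thesis
      by (simp add: basis_expansion partial_def)
  qed
  then have "frechet_derivative \<phi> (at x) = (\<lambda>h. \<Sum>i\<in>UNIV. h $ i * partial i \<phi> x)"
    by (rule ext)
  then show "(\<phi> has_derivative (\<lambda>h. \<Sum>i\<in>UNIV. h $ i * partial i \<phi> x)) (at x)"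
    using d by simp
qed

lemma partial_eq_0_outside_tsupport:
  assumes "x \<notin> tsupport \<phi>"
  shows "\<phi> x = 0" "partial i \<phi> x = 0"
proof -
  have nz: "\<phi> y = 0" if "y \<notin> tsupport \<phi>" for y
    using that closure_subset[of "{x. \<phi> x \<noteq> 0}"] by (auto simp: tsupport_def)
  then show "\<phi> x = 0"
    using assms by blast
  have "(\<phi> has_derivative (\<lambda>_. 0)) (at x)"
  proof (rule has_derivative_transform_within_open[of "\<lambda>_. 0" _ _ _ "- tsupport \<phi>"])
    show "open (- tsupport \<phi>)"
      by (simp add: tsupport_def open_Compl)
  qed (use assms nz in \<open>auto\<close>)
  then show "partial i \<phi> x = 0"
    by (metis frechet_derivative_at partial_def)
qed

text \<open>Differentiability is asked on the whole space, so that products with test functions can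
  be integrated over the whole space without boundary terms.\<close>

definition C1_gradient :: "('a::real_inner \<Rightarrow> real) \<Rightarrow> ('a \<Rightarrow> 'a) \<Rightarrow> bool" where
  "C1_gradient u G \<longleftrightarrow> (\<forall>x. (u has_derivative (\<lambda>h. G x \<bullet> h)) (at x)) \<and> continuous_on UNIV G"

lemma C1_gradient_continuous: "C1_gradient u G \<Longrightarrow> continuous_on UNIV u"
  unfolding C1_gradient_def by (meson continuous_at_imp_continuous_on has_derivative_continuous)

lemma C1_gradient_sum:
  assumes "\<And>j. j \<in> J \<Longrightarrow> C1_gradient (u j) (G j)"
  shows "C1_gradient (\<lambda>x. \<Sum>j\<in>J. u j x) (\<lambda>x. \<Sum>j\<in>J. G j x)"
  using assms unfolding C1_gradient_def inner_sum_left
  by (auto intro!: has_derivative_sum continuous_intros)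

text \<open>The integral of a partial derivative of the compactly supported product of
  \<open>u\<close> and \<phi> vanishes; the Leibniz rule splits it into the two required integrals.
  As the support of \<phi> lies in \<open>U\<close>, integrating over \<open>U\<close> or over the
  whole space is the same.\<close>

lemma weak_gradient_C1:
  fixes u :: "real^'n::finite \<Rightarrow> real"
  assumes C1: "C1_gradient u G"
  shows "weak_gradient U u G"
  unfolding weak_gradient_def
proof (intro conjI allI impI)
  have du: "(u has_derivative (\<lambda>h. G x \<bullet> h)) (at x)" for x
    using C1 by (simp add: C1_gradient_def)
  have cu: "continuous_on UNIV u"
    using C1 by (rule C1_gradient_continuous)
  have cG: "continuous_on UNIV (\<lambda>x. G x $ i)" for i
    using C1 by (auto simp: C1_gradient_def intro: continuous_intros)
  have loc: "locally_integrable_on f U" if "continuous_on UNIV f" for f :: "real^'n \<Rightarrow> real"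
    unfolding locally_integrable_on_def set_integrable_def
    by (blast intro: borel_integrable_compact continuous_on_subset[OF that])
  show "locally_integrable_on u U" "locally_integrable_on (\<lambda>x. G x $ i) U" for i
    using cu cG loc by blast+
  fix \<phi> and i :: 'n
  assume "test_fun U \<phi>"
  then have sm: "smooth_fun \<phi>" and K: "compact (tsupport \<phi>)" "tsupport \<phi> \<subseteq> U"
    by (auto simp: test_fun_def)
  have d\<phi>: "(\<phi> has_derivative (\<lambda>h. \<Sum>i\<in>UNIV. h $ i * partial i \<phi> x)) (at x)" for x
    by (rule smooth_fun_continuous_partials[OF sm])
  have c\<phi>: "continuous_on UNIV \<phi>" "continuous_on UNIV (partial i \<phi>)"
    using d\<phi> smooth_fun_continuous_partials(2)[OF sm]
    by (meson continuous_at_imp_continuous_on has_derivative_continuous, blast)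
  have int: "integrable lborel f"
    if "continuous_on UNIV f" "\<And>x. x \<notin> tsupport \<phi> \<Longrightarrow> f x = 0" for f :: "real^'n \<Rightarrow> real"
  proof -
    have "integrable lborel (\<lambda>x. indicator (tsupport \<phi>) x *\<^sub>R f x)"
      using K that(1) by (intro borel_integrable_compact) (auto intro: continuous_on_subset)
    also have "(\<lambda>x. indicator (tsupport \<phi>) x *\<^sub>R f x) = f"
      using that(2) by (force simp: fun_eq_iff indicator_def)
    finally show ?thesis .
  qed
  have drop: "(LINT x:U|lborel. f x) = (LINT x|lborel. f x)"
    if "\<And>x. x \<notin> tsupport \<phi> \<Longrightarrow> f x = 0" for f :: "real^'n \<Rightarrow> real"
    unfolding set_lebesgue_integral_def using that K(2)
    by (intro Bochner_Integration.integral_cong) (auto simp: indicator_def)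
  define f' where "f' x h = u x * (\<Sum>i\<in>UNIV. h $ i * partial i \<phi> x) + (G x \<bullet> h) * \<phi> x" for x h
  have f'i: "f' x (axis i 1) = u x * partial i \<phi> x + G x $ i * \<phi> x" for x
  proof -
    have "(\<Sum>j\<in>UNIV. axis i 1 $ j * partial j \<phi> x) = partial i \<phi> x"
      by (simp add: axis_def if_distrib[of "\<lambda>t. t * _"] cong: if_cong)
    then show ?thesis
      by (simp add: f'_def inner_axis)
  qed
  obtain R where R: "\<And>x. x \<in> tsupport \<phi> \<Longrightarrow> norm x \<le> R"
    using compact_imp_bounded[OF K(1)] by (auto simp: bounded_iff)
  have "(LINT x|lborel. f' x (axis i 1)) = 0"
  proof (rule integral_directional_derivative_eq_0)
    show "((\<lambda>x. u x * \<phi> x) has_derivative f' x) (at x)" for x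
      unfolding f'_def by (rule has_derivative_eq_rhs[OF has_derivative_mult[OF du d\<phi>]]) simp
    show "continuous_on UNIV (\<lambda>x. f' x (axis i 1))"
      unfolding f'i by (intro continuous_intros cu cG c\<phi>)
    show "u x * \<phi> x = 0" if "R < norm x" for x
      using R[of x] that partial_eq_0_outside_tsupport(1)[of x \<phi>] by fastforce
  qed
  moreover have "integrable lborel (\<lambda>x. u x * partial i \<phi> x)" "integrable lborel (\<lambda>x. G x $ i * \<phi> x)"
    by (auto intro!: int continuous_intros cu cG c\<phi> simp: partial_eq_0_outside_tsupport)
  ultimately show "(LINT x:U|lborel. u x * partial i \<phi> x) = - (LINT x:U|lborel. G x $ i * \<phi> x)"
    by (simp add: f'i drop partial_eq_0_outside_tsupport)
qed

subsection \<open>Radial bumps\<close>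

text \<open>The square of the positive part is of class C1, which is all that a continuous gradient
  demands of the cutoff built from it.\<close>

definition pos_sq :: "real \<Rightarrow> real" where
  "pos_sq t = (max 0 t)\<^sup>2"

lemma pos_sq_has_derivative: "(pos_sq has_real_derivative 2 * max 0 t) (at t)"
proof -
  consider "t < 0" | "t = 0" | "t > 0" by linarith
  then show ?thesis
  proof cases
    case 1
    have "((\<lambda>_. 0) has_real_derivative 0) (at t)"
      by simp
    then have "(pos_sq has_real_derivative 0) (at t)"
      by (rule has_field_derivative_transform_within_open[where S = "{..<0}"])
        (use 1 in \<open>auto simp: pos_sq_def\<close>)
    then show ?thesis
      using 1 by simp
  next
    case 2
    \<comment> \<open>The equality also holds at \<open>h = 0\<close>, where division by zero gives
      0.\<close>
    have "(\<lambda>h. (pos_sq (0 + h) - pos_sq 0) / h) = max 0"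
      by (auto simp: fun_eq_iff pos_sq_def max_def power2_eq_square)
    moreover have "(max 0 \<longlongrightarrow> max 0 (0::real)) (at 0)"
      by (intro tendsto_intros)
    ultimately show ?thesis
      using 2 by (simp add: DERIV_def)
  next
    case 3
    have "((\<lambda>t. t\<^sup>2) has_real_derivative 2 * t) (at t)"
      by (auto intro!: derivative_eq_intros)
    then have "(pos_sq has_real_derivative 2 * t) (at t)"
      by (rule has_field_derivative_transform_within_open[where S = "{0<..}"])
        (use 3 in \<open>auto simp: pos_sq_def\<close>)
    then show ?thesis
      using 3 by simp
  qed
qed

text \<open>A C1 profile that descends from 1 at \<open>t = 0\<close> to 0 at \<open>t = 1\<close>
  and is constant on either side.\<close>

definition cutoff :: "real \<Rightarrow> real" where
  "cutoff t = pos_sq (1 - pos_sq t)"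

definition cutoff' :: "real \<Rightarrow> real" where
  "cutoff' t = - 4 * max 0 (1 - pos_sq t) * max 0 t"

lemma cutoff_has_derivative: "(cutoff has_real_derivative cutoff' t) (at t)"
proof -
  have "((\<lambda>t. pos_sq (1 - pos_sq t)) has_real_derivative
      (2 * max 0 (1 - pos_sq t)) * (0 - 2 * max 0 t)) (at t)"
    by (rule DERIV_chain2[OF pos_sq_has_derivative])
      (intro derivative_intros pos_sq_has_derivative)
  then show ?thesis
    by (simp add: cutoff_def[abs_def] cutoff'_def algebra_simps)
qed

lemma cutoff_simps: "t \<le> 0 \<Longrightarrow> cutoff t = 1" "t \<ge> 1 \<Longrightarrow> cutoff t = 0"
  by (auto simp: cutoff_def pos_sq_def)

lemma cutoff'_nonzero:
  assumes "cutoff' t \<noteq> 0"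
  shows "0 < t" "t < 1"
proof -
  show "0 < t"
    using assms by (force simp: cutoff'_def)
  moreover have "pos_sq t < 1"
    using assms by (force simp: cutoff'_def)
  ultimately show "t < 1"
    by (auto simp: pos_sq_def power_less_one_iff abs_square_less_1)
qed

lemma cutoff'_bound: "\<bar>cutoff' t\<bar> \<le> 4"
proof (cases "cutoff' t = 0")
  case False
  have t: "0 < t" "t < 1"
    using cutoff'_nonzero False by auto
  then have "max 0 (1 - pos_sq t) * max 0 t \<le> 1 * 1"
    by (intro mult_mono) (auto simp: pos_sq_def)
  then show ?thesis
    by (simp add: cutoff'_def abs_mult)
qed auto

lemma continuous_cutoff': "continuous_on UNIV cutoff'"
  unfolding cutoff'_def pos_sq_def by (intro continuous_intros)

text \<open>Using the squared distance keeps the bump differentiable at its centre. For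
  \<open>r > 0\<close> it equals 1 up to distance r / sqrt 2 from \<open>a\<close> and 0 from
  distance \<open>r\<close> on.\<close>

definition bump :: "'a::euclidean_space \<Rightarrow> real \<Rightarrow> 'a \<Rightarrow> real" where
  "bump a r z = cutoff (2 * (norm (z - a))\<^sup>2 / r\<^sup>2 - 1)"

definition bump_grad :: "'a::euclidean_space \<Rightarrow> real \<Rightarrow> 'a \<Rightarrow> 'a" where
  "bump_grad a r z = (4 * cutoff' (2 * (norm (z - a))\<^sup>2 / r\<^sup>2 - 1) / r\<^sup>2) *\<^sub>R (z - a)"

lemma C1_gradient_bump: "C1_gradient (bump a r) (bump_grad a r)"
  unfolding C1_gradient_def
proof (intro conjI allI)
  fix z :: 'a
  have "((\<lambda>z. 2 * (norm (z - a))\<^sup>2 / r\<^sup>2 - 1) has_derivative (\<lambda>h. 4 * ((z - a) \<bullet> h) / r\<^sup>2)) (at z)"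
    unfolding power2_norm_eq_inner divide_inverse
    by (auto intro!: derivative_eq_intros simp: inner_commute)
  from has_derivative_compose[OF this cutoff_has_derivative[unfolded has_field_derivative_def]]
  show "(bump a r has_derivative (\<bullet>) (bump_grad a r z)) (at z)"
    unfolding bump_def[abs_def] by (rule has_derivative_eq_rhs) (auto simp: bump_grad_def fun_eq_iff)
  show "continuous_on UNIV (bump_grad a r)"
    unfolding bump_grad_def divide_inverse
    by (intro continuous_intros continuous_on_compose2[OF continuous_cutoff']) auto
qed

lemma bump_center [simp]: "bump a r a = 1"
  by (simp add: bump_def cutoff_simps)

lemma bump_eq_0: "0 < r \<Longrightarrow> r \<le> dist a z \<Longrightarrow> bump a r z = 0"
  unfolding bump_def by (intro cutoff_simps) (auto simp: dist_norm norm_minus_commute field_simps power_mono)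

text \<open>The gradient lives in the annulus between the radii r / sqrt 2 and \<open>r\<close>. The
  inner radius exceeds \<open>r / 2\<close>, which later separates the gradients of bumps whose
  radii differ by a factor of at least 2.\<close>

lemma bump_grad_nonzero:
  assumes "bump_grad a r z \<noteq> 0" "0 < r"
  shows "r\<^sup>2 < 2 * (dist a z)\<^sup>2" "dist a z < r"
proof -
  have *: "0 < 2 * (norm (z - a))\<^sup>2 / r\<^sup>2 - 1" "2 * (norm (z - a))\<^sup>2 / r\<^sup>2 - 1 < 1"
    using assms cutoff'_nonzero[of "2 * (norm (z - a))\<^sup>2 / r\<^sup>2 - 1"] by (auto simp: bump_grad_def)
  then show "r\<^sup>2 < 2 * (dist a z)\<^sup>2"
    using * assms(2) by (auto simp: dist_norm norm_minus_commute less_divide_eq)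
  have "(norm (z - a))\<^sup>2 < r\<^sup>2"
    using * assms(2) by (simp add: divide_less_eq)
  then show "dist a z < r"
    using assms(2) power_less_imp_less_base[of "norm (z - a)" 2 r] by (auto simp: dist_norm norm_minus_commute)
qed

text \<open>The prefactor is at most \<open>16 / r\<^sup>2\<close> since \<open>cutoff'\<close> is
  bounded by 4, and \<open>z - a\<close> has norm below \<open>r\<close> wherever the gradient is
  nonzero.\<close>

lemma norm_bump_grad_le:
  assumes "0 < r"
  shows "norm (bump_grad a r z) \<le> 16 / r"
proof (cases "bump_grad a r z = 0")
  case False
  have "\<bar>4 * cutoff' (2 * (norm (z - a))\<^sup>2 / r\<^sup>2 - 1) / r\<^sup>2\<bar> \<le> 16 / r\<^sup>2"
    using cutoff'_bound[of "2 * (norm (z - a))\<^sup>2 / r\<^sup>2 - 1"] by (auto simp: abs_mult divide_right_mono)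
  then have "norm (bump_grad a r z) \<le> 16 / r\<^sup>2 * r"
    unfolding bump_grad_def norm_scaleR using bump_grad_nonzero(2)[OF False assms] assms
    by (intro mult_mono) (auto simp: dist_norm norm_minus_commute)
  then show ?thesis
    using assms by (simp add: power2_eq_square)
qed (use assms in auto)

subsection \<open>Weighted energies\<close>

lemma open_halfspace: "open (halfspace k)"
  unfolding halfspace_def by (rule open_halfspace_component_gt_cart)

lemma borel_measurable_vec_nth [measurable]: "(\<lambda>x::real^'n::finite. x $ i) \<in> borel_measurable borel"
  by (intro borel_measurable_continuous_onI continuous_intros)

lemma halfspace_sets [measurable]: "halfspace k \<in> sets borel"
  using open_halfspace by (rule borel_open)

text \<open>By continuity the inequality fails on an open set, and an open null set is
  empty.\<close>

lemma le_everywhere_if_AE_le: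
  fixes f g :: "'a::euclidean_space \<Rightarrow> real"
  assumes "open U" "continuous_on U f" "continuous_on U g"
    and "AE z in lborel. z \<in> U \<longrightarrow> f z \<le> g z" and "z \<in> U"
  shows "f z \<le> g z"
proof (rule ccontr)
  assume "\<not> f z \<le> g z"
  define V where "V = U \<inter> (\<lambda>z. f z - g z) -` {0<..}"
  have "open V"
    unfolding V_def by (intro continuous_open_preimage continuous_intros assms open_greaterThan)
  \<comment> \<open>A closed set containing almost every point of an open set contains the whole
    open set; with the empty closed set this says that \<open>V\<close> is empty.\<close>
  moreover have "AE z\<in>V in lebesgue. z \<in> {}"
    using AE_completion[OF assms(4)] by (rule AE_mp) (auto simp: V_def)
  moreover have "z \<in> V"
    using assms(5) \<open>\<not> f z \<le> g z\<close> by (simp add: V_def)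
  ultimately have "z \<in> {}"
    using mem_closed_if_AE_lebesgue_open[OF _ closed_empty] by blast
  then show False
    by simp
qed

text \<open>At each point at most one summand is nonzero, so the power of the norm of the sum is
  that of a single term and no factor depending on the size of \<open>J\<close> is lost.\<close>

lemma wenergy_sum_disjoint_le:
  fixes G :: "'b \<Rightarrow> real^'n::finite \<Rightarrow> real^'n"
  assumes "finite J" "\<And>j. j \<in> J \<Longrightarrow> continuous_on UNIV (G j)"
    and disj: "\<And>i j z. i \<in> J \<Longrightarrow> j \<in> J \<Longrightarrow> G i z \<noteq> 0 \<Longrightarrow> G j z \<noteq> 0 \<Longrightarrow> i = j"
  shows "wenergy k p \<gamma> (\<lambda>z. \<Sum>j\<in>J. G j z) \<le> (\<Sum>j\<in>J. wenergy k p \<gamma> (G j))"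
proof -
  define e where "e v z = ennreal (norm v powr p * (z $ k) powr \<gamma>) * indicator (halfspace k) z"
    for v z :: "real^'n"
  \<comment> \<open>Here the convention \<open>0 powr p = 0\<close> matters.\<close>
  have e0: "e 0 z = 0" for z
    by (simp add: e_def)
  have "e (\<Sum>j\<in>J. G j z) z \<le> (\<Sum>j\<in>J. e (G j z) z)" for z
  proof (cases "\<exists>j\<in>J. G j z \<noteq> 0")
    case True
    then obtain j where j: "j \<in> J" "G j z \<noteq> 0"
      by blast
    then have "(\<Sum>i\<in>J. G i z) = (\<Sum>i\<in>{j}. G i z)"
      using disj by (intro sum.mono_neutral_right assms) auto
    then have "e (\<Sum>i\<in>J. G i z) z = e (G j z) z"
      by simp
    also have "\<dots> \<le> (\<Sum>j\<in>J. e (G j z) z)"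
      using j assms(1) by (intro member_le_sum) auto
    finally show ?thesis .
  qed (simp add: e0)
  then have "(\<integral>\<^sup>+z. e (\<Sum>j\<in>J. G j z) z \<partial>lborel) \<le> (\<integral>\<^sup>+z. (\<Sum>j\<in>J. e (G j z) z) \<partial>lborel)"
    by (intro nn_integral_mono) auto
  also have "\<dots> = (\<Sum>j\<in>J. \<integral>\<^sup>+z. e (G j z) z \<partial>lborel)"
  proof (rule nn_integral_sum)
    fix j assume "j \<in> J"
    then have [measurable]: "G j \<in> borel_measurable borel"
      using assms(2) by (intro borel_measurable_continuous_onI)
    show "(\<lambda>z. e (G j z) z) \<in> borel_measurable lborel"
      unfolding e_def by measurable
  qed
  finally show ?thesis
    by (simp add: wenergy_def e_def)
qed

text \<open>The gradient is at most \<open>16 / r\<close> and vanishes outside the ball, which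
  leaves only the integral of the weight to estimate.\<close>

lemma wenergy_bump_grad_le:
  fixes a :: "real^'n::finite"
  assumes "0 < r" "0 < p"
    and "(\<integral>\<^sup>+z\<in>ball a r \<inter> halfspace k. ennreal ((z $ k) powr \<gamma>) \<partial>lborel) \<le> ennreal I"
  shows "wenergy k p \<gamma> (bump_grad a r) \<le> ennreal ((16 / r) powr p * I)"
proof -
  have "wenergy k p \<gamma> (bump_grad a r) \<le> (\<integral>\<^sup>+z. ennreal ((16 / r) powr p) *
      (ennreal ((z $ k) powr \<gamma>) * indicator (ball a r \<inter> halfspace k) z) \<partial>lborel)"
    unfolding wenergy_def
  proof (intro nn_integral_mono)
    fix z
    show "ennreal (norm (bump_grad a r z) powr p * (z $ k) powr \<gamma>) * indicator (halfspace k) z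
      \<le> ennreal ((16 / r) powr p) * (ennreal ((z $ k) powr \<gamma>) * indicator (ball a r \<inter> halfspace k) z)"
    proof (cases "bump_grad a r z = 0")
      case False
      have "norm (bump_grad a r z) powr p \<le> (16 / r) powr p"
        using norm_bump_grad_le[OF assms(1)] assms(2) by (intro powr_mono2) auto
      then have "norm (bump_grad a r z) powr p * (z $ k) powr \<gamma> \<le> (16 / r) powr p * (z $ k) powr \<gamma>"
        by (intro mult_right_mono) auto
      then show ?thesis
        using bump_grad_nonzero(2)[OF False assms(1)]
        by (auto simp: indicator_def ennreal_mult[symmetric] intro!: ennreal_leI)
    qed simp
  qed
  also have "\<dots> = ennreal ((16 / r) powr p) * (\<integral>\<^sup>+z\<in>ball a r \<inter> halfspace k. ennreal ((z $ k) powr \<gamma>) \<partial>lborel)"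
    by (intro nn_integral_cmult borel_measurable_times_ennreal borel_measurable_indicator) auto
  also have "\<dots> \<le> ennreal ((16 / r) powr p) * ennreal I"
    by (intro mult_left_mono assms) auto
  also have "\<dots> = ennreal ((16 / r) powr p * I)"
    by (simp add: ennreal_mult')
  finally show ?thesis .
qed

text \<open>The logarithms of \<open>s\<close> and \<open>t\<close> differ by at most
  \<open>ln 2\<close>. This treats exponents of both signs at once.\<close>

lemma powr_le_two_powr_abs:
  fixes s t e :: real
  assumes "0 < s" "s \<le> 2 * t" "t \<le> 2 * s"
  shows "t powr e \<le> 2 powr \<bar>e\<bar> * s powr e"
proof -
  have t: "0 < t"
    using assms by linarith
  have "ln s \<le> ln 2 + ln t" "ln t \<le> ln 2 + ln s"
    using assms t by (simp_all flip: ln_mult_pos)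
  then have "\<bar>ln t - ln s\<bar> \<le> ln 2"
    by linarith
  then have "\<bar>e\<bar> * \<bar>ln t - ln s\<bar> \<le> \<bar>e\<bar> * ln 2"
    by (intro mult_left_mono) auto
  then have "e * (ln t - ln s) \<le> \<bar>e\<bar> * ln 2"
    using abs_ge_self[of "e * (ln t - ln s)"] by (simp add: abs_mult)
  then have "e * ln t \<le> \<bar>e\<bar> * ln 2 + e * ln s"
    by (simp add: algebra_simps)
  then show ?thesis
    using assms t by (simp add: powr_def exp_add[symmetric])
qed

lemma component_diff_less:
  fixes z :: "real^'n::finite"
  assumes "z \<in> ball a r"
  shows "\<bar>z $ i - a $ i\<bar> < r"
  using component_le_norm_cart[of "z - a" i] assms by (simp add: dist_norm norm_minus_commute)

text \<open>Heights in the ball stay between one half and three halves of the height of the centre,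
  so the weight is constant up to a factor.\<close>

lemma weight_integral_interior_ball:
  fixes a :: "real^'n::finite"
  assumes "0 < r" "2 * r \<le> a $ k"
  shows "(\<integral>\<^sup>+z\<in>ball a r \<inter> halfspace k. ennreal ((z $ k) powr \<gamma>) \<partial>lborel)
    \<le> ennreal (2 powr \<bar>\<gamma>\<bar> * a $ k powr \<gamma> * (unit_ball_vol (real CARD('n)) * r ^ CARD('n)))"
proof -
  have "(\<integral>\<^sup>+z\<in>ball a r \<inter> halfspace k. ennreal ((z $ k) powr \<gamma>) \<partial>lborel)
    \<le> (\<integral>\<^sup>+z. ennreal (2 powr \<bar>\<gamma>\<bar> * a $ k powr \<gamma>) * indicator (ball a r) z \<partial>lborel)"
  proof (intro nn_integral_mono)
    fix z
    show "ennreal ((z $ k) powr \<gamma>) * indicator (ball a r \<inter> halfspace k) z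
        \<le> ennreal (2 powr \<bar>\<gamma>\<bar> * a $ k powr \<gamma>) * indicator (ball a r) z"
    proof (cases "z \<in> ball a r \<inter> halfspace k")
      case True
      then have "\<bar>z $ k - a $ k\<bar> < r"
        by (intro component_diff_less) auto
      then have "(z $ k) powr \<gamma> \<le> 2 powr \<bar>\<gamma>\<bar> * a $ k powr \<gamma>"
        using assms by (intro powr_le_two_powr_abs) auto
      then show ?thesis
        using True by (auto intro: ennreal_leI)
    qed auto
  qed
  also have "\<dots> = ennreal (2 powr \<bar>\<gamma>\<bar> * a $ k powr \<gamma>) * emeasure lborel (ball a r)"
    by (rule nn_integral_cmult_indicator) auto
  also have "\<dots> = ennreal (2 powr \<bar>\<gamma>\<bar> * a $ k powr \<gamma> * (unit_ball_vol (real CARD('n)) * r ^ CARD('n)))"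
    using assms(1) by (simp add: emeasure_ball ennreal_mult)
  finally show ?thesis .
qed

text \<open>The part of the ball in the half-space lies in a box with side \<open>{0..2 * r}\<close>
  in direction \<open>k\<close> and sides of length \<open>2 * r\<close> in the others. The integral
  over the box factorises, and \<open>-1 < \<gamma>\<close> makes the weight integrable at height
  0.\<close>

lemma weight_integral_boundary_ball:
  fixes a :: "real^'n::finite"
  assumes "0 < r" "a $ k \<le> r" "-1 < \<gamma>"
  shows "(\<integral>\<^sup>+z\<in>ball a r \<inter> halfspace k. ennreal ((z $ k) powr \<gamma>) \<partial>lborel)
    \<le> ennreal ((2 * r) powr (real CARD('n) + \<gamma>) / (\<gamma> + 1))"
proof -
  define e :: "real^'n" where "e = axis k 1"
  have e: "e \<in> Basis" "z \<bullet> e = z $ k" for z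
    by (auto simp: e_def axis_in_Basis_iff inner_axis)
  define f :: "real^'n \<Rightarrow> real \<Rightarrow> ennreal" where "f b t =
    (if b = e then ennreal (t powr \<gamma>) * indicator {0..2 * r} t
     else indicator {a \<bullet> b - r..a \<bullet> b + r} t)" for b t
  have [measurable]: "f b \<in> borel_measurable borel" for b
    by (cases "b = e") (simp_all add: f_def[abs_def])
  have fe: "(\<integral>\<^sup>+t. f e t \<partial>lborel) = ennreal ((2 * r) powr (\<gamma> + 1) / (\<gamma> + 1))"
    unfolding f_def using assms
    by (simp add: nn_integral_has_integral_lebesgue'[OF _ has_integral_powr_from_0])
  have fb: "(\<integral>\<^sup>+t. f b t \<partial>lborel) = ennreal (2 * r)" if "b \<noteq> e" for b
    unfolding f_def using that assms(1) by simp
  have "(\<integral>\<^sup>+z\<in>ball a r \<inter> halfspace k. ennreal ((z $ k) powr \<gamma>) \<partial>lborel)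
    \<le> (\<integral>\<^sup>+z. (\<Prod>b\<in>Basis. f b (z \<bullet> b)) \<partial>lborel)"
  proof (intro nn_integral_mono)
    fix z
    show "ennreal ((z $ k) powr \<gamma>) * indicator (ball a r \<inter> halfspace k) z \<le> (\<Prod>b\<in>Basis. f b (z \<bullet> b))"
    proof (cases "z \<in> ball a r \<inter> halfspace k")
      case True
      have "\<bar>z $ k - a $ k\<bar> < r"
        using True by (intro component_diff_less) auto
      then have "f e (z \<bullet> e) = ennreal ((z $ k) powr \<gamma>)"
        using True assms by (simp add: f_def e halfspace_def)
      moreover have "f b (z \<bullet> b) = 1" if "b \<in> Basis - {e}" for b
        using that True Basis_le_norm[of b "z - a"]
        by (auto simp: f_def indicator_def inner_diff_left dist_norm norm_minus_commute)
      ultimately have "(\<Prod>b\<in>Basis. f b (z \<bullet> b)) = ennreal ((z $ k) powr \<gamma>)"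
        by (simp add: prod.remove[OF finite_Basis e(1)])
      then show ?thesis
        using True by simp
    qed simp
  qed
  also have "\<dots> = (\<Prod>b\<in>Basis. \<integral>\<^sup>+t. f b t \<partial>lborel)"
    by (rule nn_integral_lborel_prod) auto
  also have "\<dots> = ennreal ((2 * r) powr (\<gamma> + 1) / (\<gamma> + 1)) * ennreal ((2 * r) ^ (CARD('n) - 1))"
    using assms(1) e(1)
    by (simp add: prod.remove[OF finite_Basis e(1)] fe fb card_Diff_singleton ennreal_power)
  also have "\<dots> = ennreal ((2 * r) powr (\<gamma> + 1) / (\<gamma> + 1) * (2 * r) ^ (CARD('n) - 1))"
    by (rule ennreal_mult[symmetric]) (use assms in auto)
  also have "(2 * r) powr (\<gamma> + 1) / (\<gamma> + 1) * (2 * r) ^ (CARD('n) - 1)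
      = (2 * r) powr (real CARD('n) + \<gamma>) / (\<gamma> + 1)"
  proof -
    have "(2 * r) ^ (CARD('n) - 1) = (2 * r) powr (real CARD('n) - 1)"
      using assms(1) by (simp add: powr_realpow[symmetric] of_nat_diff Suc_leI powr_mult)
    then show ?thesis
      by (simp add: powr_add[symmetric] add_ac)
  qed
  finally show ?thesis .
qed

subsection \<open>Lower bounds for a modulus\<close>

text \<open>This packages the hypothesis on \<omega> of \<open>theorem1p2\<close> verbatim.\<close>

definition halfspace_modulus :: "'n::finite \<Rightarrow> real \<Rightarrow> real \<Rightarrow> ((real^'n) \<times> (real^'n) \<Rightarrow> real) \<Rightarrow> bool" where
  "halfspace_modulus k p \<gamma> \<omega> \<longleftrightarrow>
     continuous_on (halfspace k \<times> halfspace k) \<omega> \<and>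
     (\<forall>z \<in> halfspace k \<times> halfspace k. \<omega> z \<ge> 0) \<and>
     (\<forall>u G. weak_gradient (halfspace k) u G \<and> wenergy k p \<gamma> G < \<infinity> \<longrightarrow>
        (AE z in lborel. z \<in> halfspace k \<times> halfspace k \<longrightarrow>
           \<bar>u (fst z) - u (snd z)\<bar> \<le> \<omega> z * (enn2real (wenergy k p \<gamma> G)) powr (1 / p)))"

text \<open>Both sides of the modulus inequality are continuous on the open set of pairs, so it
  holds at every pair. Nonnegativity of \<omega> then allows replacing the energy by its bound
  \<open>K\<close>.\<close>

lemma halfspace_modulus_lower_bound:
  assumes \<omega>: "halfspace_modulus k p \<gamma> \<omega>"
    and u: "C1_gradient u G" "wenergy k p \<gamma> G \<le> ennreal K"
    and "0 \<le> K" "0 < p" "x \<in> halfspace k" "y \<in> halfspace k"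
  shows "\<bar>u x - u y\<bar> \<le> \<omega> (x, y) * K powr (1 / p)"
proof -
  define E where "E = enn2real (wenergy k p \<gamma> G)"
  have "wenergy k p \<gamma> G < \<infinity>"
    using u(2) by (simp add: order_le_less_trans)
  then have ae: "AE z in lborel. z \<in> halfspace k \<times> halfspace k \<longrightarrow>
      \<bar>u (fst z) - u (snd z)\<bar> \<le> \<omega> z * E powr (1 / p)"
    using \<omega> weak_gradient_C1[OF u(1)] unfolding halfspace_modulus_def E_def by blast
  have cu: "continuous_on (halfspace k \<times> halfspace k) (\<lambda>z. u (f z))"
    if "continuous_on UNIV f" for f
    using continuous_on_subset[OF that subset_UNIV]
    by (rule continuous_on_compose2[OF C1_gradient_continuous[OF u(1)] _ subset_UNIV])
  have "\<bar>u (fst (x, y)) - u (snd (x, y))\<bar> \<le> \<omega> (x, y) * E powr (1 / p)"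
  proof (rule le_everywhere_if_AE_le[OF _ _ _ ae])
    show "continuous_on (halfspace k \<times> halfspace k) (\<lambda>z. \<bar>u (fst z) - u (snd z)\<bar>)"
      by (intro continuous_intros cu)
    show "continuous_on (halfspace k \<times> halfspace k) (\<lambda>z. \<omega> z * E powr (1 / p))"
      using \<omega> by (intro continuous_intros) (simp add: halfspace_modulus_def)
    show "open (halfspace k \<times> halfspace k)"
      by (intro open_Times open_halfspace)
    show "(x, y) \<in> halfspace k \<times> halfspace k"
      using assms(6,7) by simp
  qed
  also have "\<dots> \<le> \<omega> (x, y) * K powr (1 / p)"
  proof (intro mult_left_mono powr_mono2)
    show "E \<le> K"
      unfolding E_def using u(2) assms(4) by (rule enn2real_leI[rotated])
    show "0 \<le> \<omega> (x, y)"
      using \<omega> assms by (auto simp: halfspace_modulus_def)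
  qed (use assms in \<open>auto simp: E_def\<close>)
  finally show ?thesis
    by simp
qed

text \<open>The bump centred at \<open>a\<close> is 1 there and 0 at \<open>b\<close>, hence
  oscillates by 1, and its energy is at most \<open>K\<close>. The set equation lets the centre be
  either of \<open>x\<close> and \<open>y\<close>.\<close>

lemma modulus_ge_interior_bump:
  fixes a b :: "real^'n::finite"
  assumes \<omega>: "halfspace_modulus k p \<gamma> \<omega>" "0 < p"
    and xy: "x \<in> halfspace k" "y \<in> halfspace k" "{a, b} = {x, y}"
    and r: "0 < r" "2 * r \<le> a $ k" "r \<le> dist a b"
  shows "r powr (1 - real CARD('n) / p) * a $ k powr (- \<gamma> / p)
    \<le> (16 powr p * 2 powr \<bar>\<gamma>\<bar> * unit_ball_vol (real CARD('n))) powr (1 / p) * \<omega> (x, y)"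
proof -
  define A where "A = 16 powr p * 2 powr \<bar>\<gamma>\<bar> * unit_ball_vol (real CARD('n))"
  define K where "K = A * (r powr (real CARD('n) - p) * a $ k powr \<gamma>)"
  have a: "0 < a $ k" and A: "0 \<le> A"
    using r by (auto simp: A_def)
  have "(16 / r) powr p * (2 powr \<bar>\<gamma>\<bar> * a $ k powr \<gamma> * (unit_ball_vol (real CARD('n)) * r ^ CARD('n))) = K"
    using r by (simp add: K_def A_def powr_divide powr_diff powr_realpow)
  then have "wenergy k p \<gamma> (bump_grad a r) \<le> ennreal K"
    using wenergy_bump_grad_le[OF r(1) \<omega>(2) weight_integral_interior_ball[OF r(1,2), of \<gamma>]] by simp
  then have "\<bar>bump a r x - bump a r y\<bar> \<le> \<omega> (x, y) * K powr (1 / p)"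
    using halfspace_modulus_lower_bound[OF \<omega>(1) C1_gradient_bump] \<omega>(2) xy A by (simp add: K_def)
  moreover have "\<bar>bump a r x - bump a r y\<bar> = 1"
    using xy(3) bump_eq_0[OF r(1,3)] by (auto simp: doubleton_eq_iff)
  moreover have "K powr (1 / p) = A powr (1 / p) * (r powr (real CARD('n) / p - 1) * a $ k powr (\<gamma> / p))"
    using \<omega>(2) A by (simp add: K_def powr_mult powr_powr diff_divide_distrib)
  ultimately have "1 \<le> A powr (1 / p) * \<omega> (x, y) * (r powr (real CARD('n) / p - 1) * a $ k powr (\<gamma> / p))"
    by (simp add: mult_ac)
  then have "(r powr (1 - real CARD('n) / p) * a $ k powr (- \<gamma> / p)) * 1
    \<le> (r powr (1 - real CARD('n) / p) * a $ k powr (- \<gamma> / p)) *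
      (A powr (1 / p) * \<omega> (x, y) * (r powr (real CARD('n) / p - 1) * a $ k powr (\<gamma> / p)))"
    by (intro mult_left_mono) auto
  also have "\<dots> = A powr (1 / p) * \<omega> (x, y) *
      (r powr (1 - real CARD('n) / p) * r powr (real CARD('n) / p - 1)) *
      (a $ k powr (- \<gamma> / p) * a $ k powr (\<gamma> / p))"
    by (simp add: mult_ac)
  also have "\<dots> = A powr (1 / p) * \<omega> (x, y)"
    using r a by (simp flip: powr_add)
  finally show ?thesis
    by (simp add: A_def)
qed

lemma wenergy_boundary_bump_le:
  fixes a :: "real^'n::finite"
  assumes "0 < r" "a $ k \<le> r" "-1 < \<gamma>" "0 < p"
  shows "wenergy k p \<gamma> (bump_grad a r)
    \<le> ennreal (16 powr p * 2 powr (real CARD('n) + \<gamma>) / (\<gamma> + 1) * r powr (real CARD('n) + \<gamma> - p))"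
proof -
  have "(16 / r) powr p * ((2 * r) powr (real CARD('n) + \<gamma>) / (\<gamma> + 1))
      = 16 powr p * 2 powr (real CARD('n) + \<gamma>) / (\<gamma> + 1) * r powr (real CARD('n) + \<gamma> - p)"
    using assms by (simp add: powr_divide powr_mult powr_diff mult_ac)
  then show ?thesis
    using wenergy_bump_grad_le[OF assms(1,4) weight_integral_boundary_ball[OF assms(1-3)]]
    by (simp only:)
qed

text \<open>Again the oscillation is 1, but the energy bound depends on the radius alone; its
  scaling exponent \<open>s\<close> is the parameter \<kappa> of the final theorem.\<close>

lemma modulus_ge_boundary_bump:
  fixes a b :: "real^'n::finite"
  assumes \<omega>: "halfspace_modulus k p \<gamma> \<omega>" "0 < p" "-1 < \<gamma>"
    and xy: "x \<in> halfspace k" "y \<in> halfspace k" "{a, b} = {x, y}"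
    and r: "0 < r" "a $ k \<le> r" "r \<le> dist a b"
  shows "r powr (1 - (real CARD('n) + \<gamma>) / p)
    \<le> (16 powr p * 2 powr (real CARD('n) + \<gamma>) / (\<gamma> + 1)) powr (1 / p) * \<omega> (x, y)"
proof -
  define A where "A = 16 powr p * 2 powr (real CARD('n) + \<gamma>) / (\<gamma> + 1)"
  define s where "s = 1 - (real CARD('n) + \<gamma>) / p"
  have A: "0 \<le> A"
    using \<omega>(3) by (simp add: A_def)
  have "\<bar>bump a r x - bump a r y\<bar> \<le> \<omega> (x, y) * (A * r powr (real CARD('n) + \<gamma> - p)) powr (1 / p)"
    using halfspace_modulus_lower_bound[OF \<omega>(1) C1_gradient_bump
        wenergy_boundary_bump_le[OF r(1,2) \<omega>(3,2)]] \<omega>(2,3) xy(1,2) by (simp add: A_def)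
  moreover have "\<bar>bump a r x - bump a r y\<bar> = 1"
    using xy(3) bump_eq_0[OF r(1,3)] by (auto simp: doubleton_eq_iff)
  moreover have "(A * r powr (real CARD('n) + \<gamma> - p)) powr (1 / p) = A powr (1 / p) * r powr (- s)"
    using \<omega>(2) A by (simp add: s_def powr_mult powr_powr diff_divide_distrib)
  ultimately have "1 \<le> A powr (1 / p) * \<omega> (x, y) * r powr (- s)"
    by (simp add: mult_ac)
  then have "r powr s * 1 \<le> r powr s * (A powr (1 / p) * \<omega> (x, y) * r powr (- s))"
    by (intro mult_left_mono) auto
  also have "\<dots> = A powr (1 / p) * \<omega> (x, y) * (r powr s * r powr (- s))"
    by (simp add: mult_ac)
  also have "\<dots> = A powr (1 / p) * \<omega> (x, y)"
    using r by (simp flip: powr_add)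
  finally show ?thesis
    by (simp add: A_def s_def)
qed

text \<open>At the critical exponent all \<open>J + 1\<close> bumps obey the same energy bound
  \<open>A\<close>. Their sum oscillates by \<open>J + 1\<close> with energy at most
  \<open>(J + 1) A\<close>, and dividing by the \<open>p\<close>-th root leaves the power
  \<open>1 - 1 / p\<close>.\<close>

lemma modulus_ge_dyadic_bumps:
  fixes a b :: "real^'n::finite"
  assumes \<omega>: "halfspace_modulus k p \<gamma> \<omega>" "0 < p" "-1 < \<gamma>" "real CARD('n) + \<gamma> = p"
    and xy: "x \<in> halfspace k" "y \<in> halfspace k" "{a, b} = {x, y}"
    and r: "0 < r" "a $ k \<le> r" "r * 2 ^ J \<le> dist a b"
  shows "real (Suc J) powr (1 - 1 / p) \<le> (16 powr p * 2 powr p / (\<gamma> + 1)) powr (1 / p) * \<omega> (x, y)"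
proof -
  define A where "A = 16 powr p * 2 powr p / (\<gamma> + 1)"
  define \<rho> where "\<rho> j = r * 2 ^ j" for j :: nat
  define u where "u z = (\<Sum>j\<le>J. bump a (\<rho> j) z)" for z
  define G where "G z = (\<Sum>j\<le>J. bump_grad a (\<rho> j) z)" for z
  have A: "0 \<le> A"
    using \<omega>(3) by (simp add: A_def)
  have \<rho>: "0 < \<rho> j" "a $ k \<le> \<rho> j" for j
  proof -
    show "0 < \<rho> j"
      using r by (simp add: \<rho>_def)
    have "r * 1 \<le> \<rho> j"
      unfolding \<rho>_def using r by (intro mult_left_mono) auto
    then show "a $ k \<le> \<rho> j"
      using r by linarith
  qed
  have \<rho>_le: "\<rho> j \<le> dist a b" if "j \<le> J" for j
  proof -
    have "\<rho> j \<le> \<rho> J"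
      unfolding \<rho>_def using r that by (intro mult_left_mono power_increasing) auto
    also have "\<rho> J \<le> dist a b"
      unfolding \<rho>_def by (rule r(3))
    finally show ?thesis .
  qed
  \<comment> \<open>The larger radius is at least twice the smaller one, so the smaller ball ends
    before the annulus of the larger bump begins.\<close>
  have disj: False if "i < j" "bump_grad a (\<rho> i) z \<noteq> 0" "bump_grad a (\<rho> j) z \<noteq> 0" for i j z
  proof -
    have "2 * \<rho> i = \<rho> (Suc i)"
      by (simp add: \<rho>_def)
    also have "\<dots> \<le> \<rho> j"
      unfolding \<rho>_def using r that(1) by (intro mult_left_mono power_increasing) auto
    finally have "2 * dist a z < \<rho> j"
      using bump_grad_nonzero(2)[OF that(2) \<rho>(1)] by linarith
    then have "(2 * dist a z)\<^sup>2 < (\<rho> j)\<^sup>2"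
      by (intro power_strict_mono) auto
    then show False
      using bump_grad_nonzero(1)[OF that(3) \<rho>(1)] zero_le_power2[of "dist a z"]
      by (simp add: power_mult_distrib)
  qed
  have "wenergy k p \<gamma> G \<le> (\<Sum>j\<le>J. wenergy k p \<gamma> (bump_grad a (\<rho> j)))"
    unfolding G_def
  proof (rule wenergy_sum_disjoint_le)
    show "continuous_on UNIV (bump_grad a (\<rho> j))" for j
      using C1_gradient_bump by (auto simp: C1_gradient_def)
    show "i = j" if "bump_grad a (\<rho> i) z \<noteq> 0" "bump_grad a (\<rho> j) z \<noteq> 0" for i j z
      using disj that by (meson linorder_neqE_nat)
  qed auto
  \<comment> \<open>The power of the radius has exponent 0 and equals 1, the radius being
    nonzero.\<close>
  also have "\<dots> \<le> (\<Sum>j\<le>J. ennreal A)"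
    using wenergy_boundary_bump_le[OF \<rho> \<omega>(3,2)] \<rho>(1) \<omega>(4)
    by (intro sum_mono) (simp add: A_def less_imp_neq[symmetric])
  also have "\<dots> = ennreal (real (Suc J) * A)"
    using A by (subst sum_ennreal) auto
  finally have "\<bar>u x - u y\<bar> \<le> \<omega> (x, y) * (real (Suc J) * A) powr (1 / p)"
    using \<omega> xy A unfolding u_def[abs_def] G_def[abs_def]
    by (intro halfspace_modulus_lower_bound[OF \<omega>(1) C1_gradient_sum]) (auto intro: C1_gradient_bump)
  moreover have "\<bar>u x - u y\<bar> = real (Suc J)"
  proof -
    have "u a = real (Suc J)" "u b = 0"
      using bump_eq_0[OF \<rho>(1) \<rho>_le] by (auto simp: u_def)
    then show ?thesis
      using xy(3) by (auto simp: doubleton_eq_iff)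
  qed
  ultimately have "real (Suc J) \<le> A powr (1 / p) * \<omega> (x, y) * real (Suc J) powr (1 / p)"
    using A by (simp add: powr_mult mult_ac)
  then have "real (Suc J) powr (- 1 / p) * real (Suc J)
      \<le> real (Suc J) powr (- 1 / p) * (A powr (1 / p) * \<omega> (x, y) * real (Suc J) powr (1 / p))"
    by (intro mult_left_mono) auto
  also have "\<dots> = A powr (1 / p) * \<omega> (x, y) * (real (Suc J) powr (- 1 / p) * real (Suc J) powr (1 / p))"
    by (simp add: mult_ac)
  also have "\<dots> = A powr (1 / p) * \<omega> (x, y)"
    by (simp flip: powr_add)
  also have "real (Suc J) powr (- 1 / p) * real (Suc J) = real (Suc J) powr (- 1 / p) * real (Suc J) powr 1"
    by simp
  also have "\<dots> = real (Suc J) powr (1 - 1 / p)"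
    unfolding powr_add[symmetric] by simp
  finally show ?thesis
    by (simp add: A_def)
qed

subsection \<open>Upper bounds for Theta\<close>

text \<open>Coinciding points need separate treatment, as no bump distinguishes them.\<close>

lemma Theta_refl: "0 < \<alpha> \<Longrightarrow> 0 < \<beta> \<Longrightarrow> Theta k \<alpha> \<beta> \<kappa> x x = 0"
  by (simp add: Theta_def Let_def)

text \<open>Both maxima in \<Theta> lie between \<open>m\<close> and \<open>2 * m\<close>, so all
  four branches are controlled by one expression. The exponent of 2 collects the losses:
  \<open>\<bar>\<kappa> - \<beta>\<bar>\<close> from the third branch,
  \<open>\<bar>\<kappa>\<bar>\<close> from the fourth.\<close>

lemma Theta_le_interior:
  fixes x y :: "real^'n::finite"
  assumes "0 < \<alpha>" "0 < \<beta>" "0 < dist x y"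
    and m: "m = min (x $ k) (y $ k)" "dist x y < m"
  shows "Theta k \<alpha> \<beta> \<kappa> x y \<le> 2 powr (\<bar>\<kappa>\<bar> + \<bar>\<kappa> - \<beta>\<bar>) * (dist x y powr \<beta> * m powr (\<kappa> - \<beta>))"
proof -
  define d M MM where "d = dist x y" "M = max (x $ k) (y $ k)" "MM = max M d"
  note defs = this
  have d: "0 < d" "d < m" "0 < m"
    using assms(3) m(2) by (simp_all only: defs)
  have "\<bar>x $ k - y $ k\<bar> \<le> d"
    using component_le_norm_cart[of "x - y" k] by (simp add: defs dist_norm)
  then have M: "m \<le> M" "M \<le> 2 * m" "m \<le> MM" "MM \<le> 2 * m"
    using m d by (auto simp: defs)
  define R where "R = d powr \<beta> * m powr (\<kappa> - \<beta>)"
  have R: "0 \<le> R"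
    by (simp add: R_def)
  have up: "R \<le> 2 powr (\<bar>\<kappa>\<bar> + \<bar>\<kappa> - \<beta>\<bar>) * R"
    using R ge_one_powr_ge_zero[of 2 "\<bar>\<kappa>\<bar> + \<bar>\<kappa> - \<beta>\<bar>"] by (simp add: mult_le_cancel_right1)
  have mM: "d powr \<beta> / MM powr \<beta> \<le> d powr \<beta> / m powr \<beta>"
    using M d assms(2) by (intro divide_left_mono powr_mono2 mult_pos_pos) auto
  consider "\<kappa> < 0" | "\<kappa> = 0" | "0 < \<kappa>" "\<kappa> < 1 + \<beta> - \<alpha>" | "0 < \<kappa>" "1 + \<beta> - \<alpha> \<le> \<kappa>"
    by linarith
  then have "Theta k \<alpha> \<beta> \<kappa> x y \<le> 2 powr (\<bar>\<kappa>\<bar> + \<bar>\<kappa> - \<beta>\<bar>) * R"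
  proof cases
    case 1
    then have "Theta k \<alpha> \<beta> \<kappa> x y = m powr \<kappa> * (d powr \<beta> / MM powr \<beta>)"
      using m d by (simp add: Theta_def Let_def defs powr_minus divide_simps)
    also have "\<dots> \<le> m powr \<kappa> * (d powr \<beta> / m powr \<beta>)"
      using mM by (intro mult_left_mono) auto
    also have "\<dots> = R"
      using d by (simp add: R_def powr_diff)
    finally show ?thesis
      using up by linarith
  next
    case 2
    then have "Theta k \<alpha> \<beta> \<kappa> x y = ln (1 + (d / m) powr (\<beta> / \<alpha>)) powr \<alpha>"
      using m d by (simp add: Theta_def Let_def defs)
    \<comment> \<open>This is \<open>ln (1 + s) \<le> s\<close>; the outer power then cancels the
      inner division by \<alpha>.\<close>
    also have "\<dots> \<le> ((d / m) powr (\<beta> / \<alpha>)) powr \<alpha>"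
      using assms(1) by (intro powr_mono2 ln_add_one_self_le_self ln_ge_zero) auto
    also have "\<dots> = R"
      using d assms(1) 2 by (simp add: R_def powr_powr powr_divide powr_minus_divide)
    finally show ?thesis
      using up by linarith
  next
    case 3
    then have "Theta k \<alpha> \<beta> \<kappa> x y = d powr \<beta> * MM powr (\<kappa> - \<beta>)"
      by (simp add: Theta_def Let_def defs powr_diff)
    also have "\<dots> \<le> d powr \<beta> * (2 powr \<bar>\<kappa> - \<beta>\<bar> * m powr (\<kappa> - \<beta>))"
      using M d by (intro mult_left_mono powr_le_two_powr_abs) auto
    also have "\<dots> = 2 powr \<bar>\<kappa> - \<beta>\<bar> * R"
      by (simp add: R_def)
    also have "\<dots> \<le> 2 powr (\<bar>\<kappa>\<bar> + \<bar>\<kappa> - \<beta>\<bar>) * R"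
      using R by (intro mult_right_mono powr_mono) auto
    finally show ?thesis .
  next
    case 4
    then have "Theta k \<alpha> \<beta> \<kappa> x y = M powr \<kappa> * (d powr \<beta> / MM powr \<beta>)"
      by (simp add: Theta_def Let_def defs)
    also have "\<dots> \<le> (2 powr \<bar>\<kappa>\<bar> * m powr \<kappa>) * (d powr \<beta> / m powr \<beta>)"
      using M d mM by (intro mult_mono powr_le_two_powr_abs) auto
    also have "\<dots> = 2 powr \<bar>\<kappa>\<bar> * R"
      using d by (simp add: R_def powr_diff)
    also have "\<dots> \<le> 2 powr (\<bar>\<kappa>\<bar> + \<bar>\<kappa> - \<beta>\<bar>) * R"
      using R by (intro mult_right_mono powr_mono) auto
    finally show ?thesis .
  qed
  then show ?thesis
    by (simp add: R_def defs)
qed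

text \<open>Here \<open>MM\<close> lies between \<open>d\<close> and \<open>2 * d\<close>, because
  the heights differ by at most \<open>d\<close> and \<open>m \<le> d\<close>. The logarithmic
  branch is left to the dyadic estimate.\<close>

lemma Theta_le_boundary:
  fixes x y :: "real^'n::finite"
  assumes "0 < \<beta>"
    and m: "m = min (x $ k) (y $ k)" "0 < m" "m \<le> dist x y"
  shows "\<kappa> < 0 \<Longrightarrow> Theta k \<alpha> \<beta> \<kappa> x y \<le> m powr \<kappa>"
    and "0 < \<kappa> \<Longrightarrow> \<kappa> < 1 + \<beta> - \<alpha> \<Longrightarrow> Theta k \<alpha> \<beta> \<kappa> x y \<le> 2 powr \<bar>\<kappa> - \<beta>\<bar> * dist x y powr \<kappa>"
    and "0 < \<kappa> \<Longrightarrow> 1 + \<beta> - \<alpha> \<le> \<kappa> \<Longrightarrow> Theta k \<alpha> \<beta> \<kappa> x y \<le> max (x $ k) (y $ k) powr \<kappa>"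
proof -
  define d M MM where "d = dist x y" "M = max (x $ k) (y $ k)" "MM = max M d"
  note defs = this
  have d: "0 < d"
    using assms by (auto simp: defs)
  have "\<bar>x $ k - y $ k\<bar> \<le> d"
    using component_le_norm_cart[of "x - y" k] by (simp add: defs dist_norm)
  then have M: "d \<le> MM" "MM \<le> 2 * d"
    using m d by (auto simp: defs)
  have dM: "d powr \<beta> / MM powr \<beta> \<le> 1"
    using M d powr_mono2[of \<beta> d MM] assms(1) by (simp add: divide_le_eq)
  show "Theta k \<alpha> \<beta> \<kappa> x y \<le> m powr \<kappa>" if "\<kappa> < 0"
  proof -
    have "Theta k \<alpha> \<beta> \<kappa> x y = m powr \<kappa> * (d powr \<beta> / MM powr \<beta>)"
      using m d that by (simp add: Theta_def Let_def defs powr_minus divide_simps)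
    also have "\<dots> \<le> m powr \<kappa> * 1"
      using dM by (intro mult_left_mono) auto
    finally show ?thesis
      by simp
  qed
  show "Theta k \<alpha> \<beta> \<kappa> x y \<le> 2 powr \<bar>\<kappa> - \<beta>\<bar> * dist x y powr \<kappa>" if "0 < \<kappa>" "\<kappa> < 1 + \<beta> - \<alpha>"
  proof -
    have "Theta k \<alpha> \<beta> \<kappa> x y = d powr \<beta> * MM powr (\<kappa> - \<beta>)"
      using that by (simp add: Theta_def Let_def defs powr_diff)
    also have "\<dots> \<le> d powr \<beta> * (2 powr \<bar>\<kappa> - \<beta>\<bar> * d powr (\<kappa> - \<beta>))"
      using M d by (intro mult_left_mono powr_le_two_powr_abs) auto
    also have "\<dots> = 2 powr \<bar>\<kappa> - \<beta>\<bar> * d powr \<kappa>"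
      using d by (simp add: powr_diff)
    finally show ?thesis
      by (simp add: defs)
  qed
  show "Theta k \<alpha> \<beta> \<kappa> x y \<le> max (x $ k) (y $ k) powr \<kappa>" if "0 < \<kappa>" "1 + \<beta> - \<alpha> \<le> \<kappa>"
  proof -
    have "Theta k \<alpha> \<beta> \<kappa> x y = M powr \<kappa> * (d powr \<beta> / MM powr \<beta>)"
      using that by (simp add: Theta_def Let_def defs)
    also have "\<dots> \<le> M powr \<kappa> * 1"
      using dM by (intro mult_left_mono) auto
    finally show ?thesis
      by (simp add: defs)
  qed
qed

text \<open>With \<open>J\<close> the integer part of \<open>log 2 t\<close>, \<open>ln t\<close> is
  at most \<open>(J + 1) ln 2\<close>, and \<open>1 + t powr q \<le> 2 * t powr q\<close> turns the
  logarithm into at most \<open>(1 + q) (J + 1)\<close>. The count \<open>J + 1\<close> is that of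
  the bumps.\<close>

lemma dyadic_Theta_bound:
  fixes t \<alpha> \<beta> :: real
  assumes "0 < \<alpha>" "0 < \<beta>" "1 \<le> t"
  obtains J :: nat where "2 ^ J \<le> t"
    "ln (1 + t powr (\<beta> / \<alpha>)) powr \<alpha> \<le> (1 + \<beta> / \<alpha>) powr \<alpha> * real (Suc J) powr \<alpha>"
proof -
  define J where "J = nat \<lfloor>log 2 t\<rfloor>"
  define q where "q = \<beta> / \<alpha>"
  have q: "0 < q"
    using assms by (simp add: q_def)
  have "0 \<le> log 2 t"
    using assms by simp
  then have J: "real J \<le> log 2 t" "log 2 t < real (Suc J)"
    unfolding J_def by linarith+
  have lo: "2 ^ J \<le> t"
    using J(1) assms(3) by (simp add: le_log_iff powr_realpow)
  have lnt: "ln t \<le> real (Suc J) * ln 2"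
    using J(2) by (simp add: log_def divide_less_eq)
  have ln2: "ln 2 \<le> (1::real)"
    using ln_le_minus_one[of 2] by simp
  have "1 \<le> t powr q"
    using assms q by (intro ge_one_powr_ge_zero) auto
  then have "ln (1 + t powr q) \<le> ln (2 * t powr q)"
    by (intro ln_mono) auto
  also have "\<dots> = ln 2 + q * ln t"
    using assms by (simp add: ln_mult_pos ln_powr)
  also have "\<dots> \<le> real (Suc J) * ln 2 + q * (real (Suc J) * ln 2)"
    using lnt q by (intro add_mono mult_left_mono) (auto simp: distrib_right)
  also have "\<dots> = (1 + q) * real (Suc J) * ln 2"
    by (simp add: algebra_simps)
  also have "\<dots> \<le> (1 + q) * real (Suc J) * 1"
    using ln2 q by (intro mult_left_mono) auto
  finally have "ln (1 + t powr q) powr \<alpha> \<le> ((1 + q) * real (Suc J)) powr \<alpha>"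
    using assms(1) by (intro powr_mono2 ln_ge_zero) auto
  also have "\<dots> = (1 + q) powr \<alpha> * real (Suc J) powr \<alpha>"
    using q by (simp add: powr_mult)
  finally show thesis
    using lo that unfolding q_def by blast
qed

section \<open>Choice of the constant and case distinction on the two points\<close>

theorem theorem1p2:
  fixes k :: "'n::finite" and \<gamma> p :: real
  assumes "real CARD('n) < p"
  shows "\<exists>C>0. \<forall>\<omega> :: ((real^'n) \<times> (real^'n)) \<Rightarrow> real.
     continuous_on (halfspace k \<times> halfspace k) \<omega> \<and>
     (\<forall>z \<in> halfspace k \<times> halfspace k. \<omega> z \<ge> 0) \<and>
     (\<forall>u G. weak_gradient (halfspace k) u G \<and> wenergy k p \<gamma> G < \<infinity> \<longrightarrow>
        (AE z in lborel. z \<in> halfspace k \<times> halfspace k \<longrightarrow>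
           \<bar>u (fst z) - u (snd z)\<bar> \<le> \<omega> z * (enn2real (wenergy k p \<gamma> G)) powr (1 / p)))
     \<longrightarrow> (\<forall>x \<in> halfspace k. \<forall>y \<in> halfspace k.
            \<omega> (x, y) \<ge> C * Theta k (1 - 1/p) (1 - real CARD('n) / p) (1 - (real CARD('n) + \<gamma>) / p) x y)"
proof -
  define n where "n = real CARD('n)"
  define \<alpha> where "\<alpha> = 1 - 1 / p"
  define \<beta> where "\<beta> = 1 - n / p"
  define \<kappa> where "\<kappa> = 1 - (n + \<gamma>) / p"
  have n: "1 \<le> n"
    by (simp add: n_def Suc_leI)
  then have p: "n < p" "0 < p" "1 < p"
    using assms unfolding n_def by linarith+
  have \<alpha>\<beta>: "0 < \<alpha>" "0 < \<beta>"
    using p by (auto simp: \<alpha>_def \<beta>_def)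
  \<comment> \<open>A bump whose radius is comparable to its height \<open>h\<close> yields
    \<open>h powr \<beta> * h powr (- \<gamma> / p)\<close>, which is
    \<open>h powr \<kappa>\<close>.\<close>
  have \<kappa>_eq: "\<kappa> = \<beta> + - \<gamma> / p"
    by (simp add: \<kappa>_def \<beta>_def add_divide_distrib)
  \<comment> \<open>The threshold between the last two branches of \<Theta> is exactly integrability
    of the weight at the boundary.\<close>
  have \<kappa>_less: "\<kappa> < 1 + \<beta> - \<alpha> \<longleftrightarrow> -1 < \<gamma>"
  proof -
    have "- \<gamma> / p < 1 / p \<longleftrightarrow> - \<gamma> < 1"
      using p by (subst divide_less_cancel) auto
    then show ?thesis
      unfolding \<kappa>_eq \<alpha>_def by linarith
  qed
  have \<kappa>_0: "\<kappa> = 0 \<longleftrightarrow> n + \<gamma> = p"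
    using p by (auto simp: \<kappa>_def)
  define A where "A = (16 powr p * 2 powr \<bar>\<gamma>\<bar> * unit_ball_vol n) powr (1 / p)"
  \<comment> \<open>For \<open>\<gamma> \<le> -1\<close> this value has no meaning, but it is
    nonnegative like every \<open>powr\<close>; it is applied only when
    \<open>-1 < \<gamma>\<close>.\<close>
  define B where "B = (16 powr p * 2 powr (n + \<gamma>) / (\<gamma> + 1)) powr (1 / p)"
  define C1 where "C1 = 2 powr (\<bar>\<kappa>\<bar> + \<bar>\<kappa> - \<beta>\<bar>) * (2 powr \<beta> * A)"
  define C2 where "C2 = 2 powr \<beta> * A"
  define C3 where "C3 = (1 + \<beta> / \<alpha>) powr \<alpha> * B"
  define C4 where "C4 = 2 powr \<bar>\<kappa> - \<beta>\<bar> * B"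
  have C_nonneg: "0 \<le> C1" "0 \<le> C2" "0 \<le> C3" "0 \<le> C4"
    by (auto simp: C1_def C2_def C3_def C4_def A_def B_def)
  \<comment> \<open>The sum dominates the constant of every case, and the summand 1 makes it
    positive. The theorem receives \<open>1 / C\<close>.\<close>
  define C where "C = 1 + C1 + C2 + C3 + C4"
  have "0 < C"
    using C_nonneg by (simp add: C_def)
  have main: "Theta k \<alpha> \<beta> \<kappa> x y \<le> C * \<omega> (x, y)"
    if \<omega>: "halfspace_modulus k p \<gamma> \<omega>" and x: "x \<in> halfspace k" and y: "y \<in> halfspace k" for \<omega> x y
  proof -
    define m where "m = min (x $ k) (y $ k)"
    define M where "M = max (x $ k) (y $ k)"
    have m: "0 < m" "m \<le> M"
      using x y by (auto simp: m_def M_def halfspace_def)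
    have \<omega>0: "0 \<le> \<omega> (x, y)"
      using \<omega> x y by (simp add: halfspace_modulus_def)
    have le_C: "Theta k \<alpha> \<beta> \<kappa> x y \<le> C * \<omega> (x, y)"
      if "Theta k \<alpha> \<beta> \<kappa> x y \<le> c * \<omega> (x, y)" "c \<le> C" for c
      using that(1) mult_right_mono[OF that(2) \<omega>0] by (rule order_trans)
    have "\<exists>a b. {a, b} = {x, y} \<and> a $ k = m"
      by (cases "x $ k \<le> y $ k") (auto simp: m_def)
    then obtain a b where ab: "{a, b} = {x, y}" "a $ k = m"
      by blast
    then have dab: "dist a b = dist x y"
      by (auto simp: doubleton_eq_iff dist_commute)
    have "\<exists>a b. {a, b} = {x, y} \<and> a $ k = M"
      by (cases "x $ k \<le> y $ k") (auto simp: M_def)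
    then obtain a' b' where ab': "{a', b'} = {x, y}" "a' $ k = M"
      by blast
    then have dab': "dist a' b' = dist x y"
      by (auto simp: doubleton_eq_iff dist_commute)
    have M_le: "M \<le> m + dist x y"
      using component_le_norm_cart[of "x - y" k] by (auto simp: m_def M_def dist_norm)
    \<comment> \<open>The bump has radius \<open>s / 2\<close>, which fits both the height
      \<open>v\<close> and the distance of the points; the factor \<open>2 powr \<beta>\<close> in
      \<open>C2\<close> undoes the halving.\<close>
    have interior: "s powr \<beta> * v powr (- \<gamma> / p) \<le> C2 * \<omega> (x, y)"
      if "{c, e} = {x, y}" "c $ k = v" "0 < s" "s \<le> v" "s \<le> 2 * dist x y" "dist c e = dist x y" for c e s v
    proof -
      have "(s / 2) powr \<beta> * v powr (- \<gamma> / p) \<le> A * \<omega> (x, y)"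
        using modulus_ge_interior_bump[OF \<omega> p(2) x y that(1), of "s / 2"] that
        unfolding A_def n_def \<beta>_def by simp
      then have "2 powr \<beta> * ((s / 2) powr \<beta> * v powr (- \<gamma> / p)) \<le> 2 powr \<beta> * (A * \<omega> (x, y))"
        by (intro mult_left_mono) auto
      then show ?thesis
        using that(3) by (simp add: C2_def powr_divide mult_ac)
    qed
    consider "x = y" | "0 < dist x y" "dist x y < m" | "m \<le> dist x y"
      by fastforce
    then show ?thesis
    proof cases
      case 1
      then show ?thesis
        using \<omega>0 \<open>0 < C\<close> by (simp add: Theta_refl[OF \<alpha>\<beta>])
    next
      case 2
      have "Theta k \<alpha> \<beta> \<kappa> x y
          \<le> 2 powr (\<bar>\<kappa>\<bar> + \<bar>\<kappa> - \<beta>\<bar>) * (dist x y powr \<beta> * m powr (\<kappa> - \<beta>))"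
        by (rule Theta_le_interior[OF \<alpha>\<beta> 2(1) m_def 2(2)])
      also have "m powr (\<kappa> - \<beta>) = m powr (- \<gamma> / p)"
        by (simp add: \<kappa>_eq)
      also have "2 powr (\<bar>\<kappa>\<bar> + \<bar>\<kappa> - \<beta>\<bar>) * (dist x y powr \<beta> * m powr (- \<gamma> / p))
          \<le> 2 powr (\<bar>\<kappa>\<bar> + \<bar>\<kappa> - \<beta>\<bar>) * (C2 * \<omega> (x, y))"
        using 2 by (intro mult_left_mono interior[OF ab _ _ _ dab]) auto
      also have "\<dots> = C1 * \<omega> (x, y)"
        by (simp add: C1_def C2_def)
      finally show ?thesis
        by (rule le_C) (use C_nonneg in \<open>simp add: C_def\<close>)
    next
      case 3
      consider "\<kappa> < 0" | "\<kappa> = 0" | "0 < \<kappa>" "\<kappa> < 1 + \<beta> - \<alpha>" | "0 < \<kappa>" "1 + \<beta> - \<alpha> \<le> \<kappa>"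
        by linarith
      then show ?thesis
      proof cases
        case 1
        then have "Theta k \<alpha> \<beta> \<kappa> x y \<le> m powr \<kappa>"
          by (rule Theta_le_boundary(1)[OF \<alpha>\<beta>(2) m_def m(1) 3])
        also have "\<dots> = m powr \<beta> * m powr (- \<gamma> / p)"
          unfolding \<kappa>_eq by (rule powr_add)
        also have "\<dots> \<le> C2 * \<omega> (x, y)"
          using m 3 by (intro interior[OF ab _ _ _ dab]) auto
        finally show ?thesis
          by (rule le_C) (use C_nonneg in \<open>simp add: C_def\<close>)
      next
        case 2
        \<comment> \<open>Here \<gamma> is \<open>p - n\<close>, which is positive.\<close>
        have \<gamma>: "n + \<gamma> = p" "-1 < \<gamma>"
          using 2 \<kappa>_0 p by auto
        have "1 \<le> dist x y / m"
          using m 3 by simp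
        then obtain J where J: "2 ^ J \<le> dist x y / m"
          "ln (1 + (dist x y / m) powr (\<beta> / \<alpha>)) powr \<alpha> \<le> (1 + \<beta> / \<alpha>) powr \<alpha> * real (Suc J) powr \<alpha>"
          using dyadic_Theta_bound[OF \<alpha>\<beta>] by blast
        have "m * 2 ^ J \<le> dist x y"
          using J(1) m(1) by (simp add: field_simps)
        \<comment> \<open>The smallest radius is \<open>m\<close>, the height of the centre, so
          every bump falls under the boundary estimate.\<close>
        then have "real (Suc J) powr \<alpha> \<le> B * \<omega> (x, y)"
          using modulus_ge_dyadic_bumps[OF \<omega> p(2) \<gamma>(2) _ x y ab(1) m(1), of J] ab dab \<gamma>
          unfolding B_def \<alpha>_def n_def by simp
        then have *: "(1 + \<beta> / \<alpha>) powr \<alpha> * real (Suc J) powr \<alpha> \<le> (1 + \<beta> / \<alpha>) powr \<alpha> * (B * \<omega> (x, y))"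
          by (intro mult_left_mono) auto
        have "Theta k \<alpha> \<beta> \<kappa> x y = ln (1 + (dist x y / m) powr (\<beta> / \<alpha>)) powr \<alpha>"
          using 2 by (simp add: Theta_def Let_def m_def)
        also have "\<dots> \<le> C3 * \<omega> (x, y)"
          using order_trans[OF J(2) *] by (simp add: C3_def mult_ac)
        finally show ?thesis
          by (rule le_C) (use C_nonneg in \<open>simp add: C_def\<close>)
      next
        case mid: 3
        have "x \<noteq> y"
          using m 3 by auto
        \<comment> \<open>The radius is the full distance, which is at least the height
          \<open>m\<close> of the centre.\<close>
        then have "dist x y powr \<kappa> \<le> B * \<omega> (x, y)"
          using modulus_ge_boundary_bump[OF \<omega> p(2) _ x y ab(1), of "dist x y"] ab dab m 3 mid(2) \<kappa>_less
          unfolding B_def \<kappa>_def n_def by simp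
        then have "2 powr \<bar>\<kappa> - \<beta>\<bar> * dist x y powr \<kappa> \<le> 2 powr \<bar>\<kappa> - \<beta>\<bar> * (B * \<omega> (x, y))"
          by (intro mult_left_mono) auto
        from order_trans[OF Theta_le_boundary(2)[OF \<alpha>\<beta>(2) m_def m(1) 3 mid] this]
        have "Theta k \<alpha> \<beta> \<kappa> x y \<le> C4 * \<omega> (x, y)"
          by (simp add: C4_def mult.assoc)
        then show ?thesis
          by (rule le_C) (use C_nonneg in \<open>simp add: C_def\<close>)
      next
        case 4
        then have "Theta k \<alpha> \<beta> \<kappa> x y \<le> M powr \<kappa>"
          unfolding M_def by (rule Theta_le_boundary(3)[OF \<alpha>\<beta>(2) m_def m(1) 3])
        also have "\<dots> = M powr \<beta> * M powr (- \<gamma> / p)"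
          unfolding \<kappa>_eq by (rule powr_add)
        \<comment> \<open>The centre is now the higher point, with \<open>s = v = M\<close>;
          \<open>M_le\<close> and \<open>m \<le> dist x y\<close> give the required
          \<open>M \<le> 2 * dist x y\<close>.\<close>
        also have "\<dots> \<le> C2 * \<omega> (x, y)"
          using m 3 M_le by (intro interior[OF ab' _ _ _ dab']) auto
        finally show ?thesis
          by (rule le_C) (use C_nonneg in \<open>simp add: C_def\<close>)
      qed
    qed
  qed
  show ?thesis
  proof (intro exI[of _ "1 / C"] conjI allI impI ballI)
    fix \<omega> :: "(real^'n) \<times> (real^'n) \<Rightarrow> real" and x y
    assume "continuous_on (halfspace k \<times> halfspace k) \<omega> \<and>
     (\<forall>z \<in> halfspace k \<times> halfspace k. \<omega> z \<ge> 0) \<and>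
     (\<forall>u G. weak_gradient (halfspace k) u G \<and> wenergy k p \<gamma> G < \<infinity> \<longrightarrow>
        (AE z in lborel. z \<in> halfspace k \<times> halfspace k \<longrightarrow>
           \<bar>u (fst z) - u (snd z)\<bar> \<le> \<omega> z * (enn2real (wenergy k p \<gamma> G)) powr (1 / p)))"
    then have "halfspace_modulus k p \<gamma> \<omega>"
      unfolding halfspace_modulus_def .
    moreover assume "x \<in> halfspace k" "y \<in> halfspace k"
    ultimately have "Theta k \<alpha> \<beta> \<kappa> x y \<le> C * \<omega> (x, y)"
      by (rule main)
    then show "1 / C * Theta k (1 - 1/p) (1 - real CARD('n) / p) (1 - (real CARD('n) + \<gamma>) / p) x y \<le> \<omega> (x, y)"
      using \<open>0 < C\<close> by (simp add: \<alpha>_def \<beta>_def \<kappa>_def n_def divide_le_eq mult.commute)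
  qed (use \<open>0 < C\<close> in simp)
qed

end
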